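(* Let $\mu$ be a (positive) measure on $\mathbb{C}$ with $\mu(\mathbb{C})=1$, and let $$V(t)=\int_{\mathbb{C}}\log\left|1-\frac{t}{\zeta}\right|\,d\mu(\zeta)$$ be its logarithmic potential. Assume that $\lim_{|t|\to\infty}[V(t)-\log|t|]$ exists (as a finite limit), that $\int_{\mathbb{C}}|\log|t||\,d\mu(t)<\infty$, and that $V$ is continuous in $\mathbb{C}$. Then for each $\epsilon>0$ there exist a number $N$ and polynomials $p(t)$ and $q(t)$ of degree $N$ such that $$\left|V(t)-\frac{1}{N}\max\{\log|p(t)|,\log|q(t)|\}\right|<\epsilon,\qquad t\in\mathbb{C}.$$
   Context: Polynomials are holomorphic polynomials in one complex variable; $N$ is a positive integer. *)

theory Defs
  imports "HOL-Probability.Probability_Measure" "HOL-Computational_Algebra.Polynomial"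
begin

text \<open>
  The library's real logarithm has \<open>ln 0 = 0\<close>. Potentials of measures with atoms, and
  \<open>max (log \<bar>p\<bar>) (log \<bar>q\<bar>)\<close> at zeros of \<open>p\<close> or \<open>q\<close>, need \<open>log 0 = -\<infinity>\<close>. Only arguments
  \<open>x \<ge> 0\<close> matter.
\<close>

definition elog :: "real \<Rightarrow> ereal" where
  "elog x = (if x \<le> 0 then - \<infinity> else ereal (ln x))"

text \<open>
  The integral of an extended-real function as \<open>\<integral> f\<^sup>+ - \<integral> f\<^sup>-\<close>; \<open>e2ennreal\<close> sends negative
  values to \<open>0\<close>. The undefined case \<open>\<infinity> - \<infinity>\<close> evaluates to \<open>\<infinity>\<close> in type \<open>ereal\<close>. Unlike with the
  Bochner integral, a divergent integral is never assigned a finite value.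
\<close>

definition ereal_integral :: "'a measure \<Rightarrow> ('a \<Rightarrow> ereal) \<Rightarrow> ereal" where
  "ereal_integral M f =
     enn2ereal (\<integral>\<^sup>+ x. e2ennreal (f x) \<partial>M) - enn2ereal (\<integral>\<^sup>+ x. e2ennreal (- f x) \<partial>M)"

text \<open>
  At \<open>\<zeta> = 0\<close> the integrand below is \<open>elog 1 = 0\<close>, by \<open>t / 0 = 0\<close>. This value is immaterial
  whenever \<open>\<mu>\<close> has no mass at \<open>0\<close>, in particular if \<open>\<integral> \<bar>log \<bar>t\<bar>\<bar> d\<mu> < \<infinity>\<close> with \<open>log 0 = -\<infinity>\<close>.
\<close>

definition log_potential :: "complex measure \<Rightarrow> complex \<Rightarrow> ereal" where
  "log_potential \<mu> t = ereal_integral \<mu> (\<lambda>\<zeta>. elog (cmod (1 - t / \<zeta>)))"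

end

theory Submission
  imports Defs "HOL-Analysis.Analysis" "HOL-Real_Asymp.Real_Asymp"
begin

text \<open>
  Up to an additive constant, \<open>V\<close> is the potential \<open>U\<close> with kernel \<open>ln \<bar>t - \<zeta>\<bar>\<close>. Replacing this
  kernel by \<open>max (ln \<bar>t - \<zeta>\<bar>) (ln d)\<close> increases \<open>U\<close> by an amount that decreases to \<open>0\<close> with \<open>d\<close>,
  and uniformly so: by Dini's argument on compact sets, and near infinity because the existence of
  \<open>lim (V t - ln \<bar>t\<bar>)\<close> forces the increment to vanish there. The truncated kernel is Lipschitz in
  \<open>\<zeta>\<close> with logarithmic growth, so \<open>\<mu>\<close> may be replaced by finitely many atoms \<open>a\<close> with weights
  \<open>n a / N\<close>, uniformly in \<open>t\<close>. Finally \<open>\<bar>z ^ n - d ^ n\<bar>\<close> is comparable to \<open>max \<bar>z\<bar> d ^ n\<close> away from tiny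
  discs around its zeros, so \<open>p t = (\<Prod>a. (t - a) ^ n a - d ^ n a)\<close>
  has \<open>ln \<bar>p t\<bar> / N\<close> uniformly close to \<open>U t\<close> outside
  the discs around its \<open>N\<close> zeros. Its translate \<open>q t = p (t + h)\<close> does the same, and by
  pigeonhole a small shift \<open>h\<close> keeps the zeros of \<open>p\<close> and \<open>q\<close> at mutual distances of order at least
  \<open>1 / N ^ 2\<close>, so that the small discs of \<open>p\<close> and \<open>q\<close> are disjoint.
\<close>

subsection \<open>The truncated logarithm and roots of unity\<close>

text \<open>The mean of \<open>ln \<bar>z - w\<bar>\<close> over the circle \<open>\<bar>w\<bar> = d\<close>.\<close>

definition tlog :: "real \<Rightarrow> complex \<Rightarrow> real" where
  "tlog d z = ln (max (cmod z) d)"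

text \<open>Moving from \<open>w\<close> to \<open>z\<close> multiplies
  \<open>max (cmod w) d\<close>, which is at least \<open>d\<close>, by at most
  \<open>1 + cmod (z - w) / d\<close>. The logarithm is kept because this form of the bound is
  integrable under a logarithmic moment; the linear bound derived from it need not be.\<close>

lemma tlog_diff_le:
  assumes "0 < d"
  shows "\<bar>tlog d z - tlog d w\<bar> \<le> ln (1 + cmod (z - w) / d)"
proof -
  have "tlog d x - tlog d y \<le> ln (1 + cmod (x - y) / d)" for x y
  proof -
    have "cmod x \<le> cmod y + cmod (x - y)"
      by (rule norm_triangle_sub)
    then have "max (cmod x) d \<le> max (cmod y) d + cmod (x - y)"
      using norm_ge_zero[of "x - y"] by linarith
    also have "cmod (x - y) = cmod (x - y) * (d / d)"
      using assms by simp
    also have "cmod (x - y) * (d / d) \<le> cmod (x - y) * (max (cmod y) d / d)"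
      using assms by (intro mult_left_mono divide_right_mono) auto
    also have "max (cmod y) d + cmod (x - y) * (max (cmod y) d / d) = max (cmod y) d * (1 + cmod (x - y) / d)"
      by (simp add: algebra_simps)
    finally have "ln (max (cmod x) d) \<le> ln (max (cmod y) d * (1 + cmod (x - y) / d))"
      using assms by (subst ln_le_cancel_iff) (auto intro!: mult_pos_pos add_pos_nonneg)
    also have "\<dots> = ln (max (cmod y) d) + ln (1 + cmod (x - y) / d)"
      using assms by (intro ln_mult_pos) (auto intro!: add_pos_nonneg)
    finally show ?thesis by (simp add: tlog_def)
  qed
  from this[of z w] this[of w z] show ?thesis
    by (simp add: norm_minus_commute)
qed

lemma tlog_diff_le_norm:
  assumes "0 < d"
  shows "\<bar>tlog d z - tlog d w\<bar> \<le> cmod (z - w) / d"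
  using tlog_diff_le[OF assms, of z w] ln_add_one_self_le_self[of "cmod (z - w) / d"] assms
  by simp

text \<open>Dividing \<open>w\<close> by \<open>exp (Ln s / n)\<close>, an \<open>n\<close>-th root
  of \<open>s = w ^ n\<close> close to \<open>1\<close>, leaves an exact root of unity. The constant
  \<open>6\<close> does not depend on \<open>n\<close>: a factor \<open>2\<close> comes from
  \<open>Ln\<close> near \<open>1\<close> and a factor \<open>3\<close> from
  \<open>exp x - 1\<close>.\<close>

lemma near_root_of_unity:
  fixes w :: complex
  assumes "n > 0" "norm (w ^ n - 1) \<le> 1 / 4"
  obtains v where "v ^ n = 1" "norm (w - v) \<le> 6 * norm (w ^ n - 1)"
proof -
  define s where "s = w ^ n"
  define x where "x = Ln s / of_nat n"
  have s: "norm (s - 1) \<le> 1 / 4" using assms by (simp add: s_def)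
  then have s0: "s \<noteq> 0" by auto
  have "norm (Ln (1 + (s - 1))) \<le> 2 * norm (s - 1)"
    by (rule norm_Ln_le) (use s in auto)
  then have "norm (Ln s) \<le> 2 * norm (s - 1)" by simp
  moreover have "norm x \<le> norm (Ln s)"
    using assms(1) by (simp add: x_def norm_divide divide_le_eq mult_left_le mult_le_cancel_left1)
  ultimately have x: "norm x \<le> 2 * norm (s - 1)" by simp
  have xn: "exp x ^ n = s"
    using assms(1) s0 by (simp add: x_def exp_of_nat_mult[symmetric])
  define v where "v = w / exp x"
  have "v ^ n = 1" using xn s0 by (simp add: v_def power_divide s_def)
  moreover have "norm v = 1" using calculation assms(1) by (metis norm_power norm_one power_eq_imp_eq_base power_one zero_le_one norm_ge_zero)
  moreover have "w - v = v * (exp x - 1)" by (simp add: v_def field_simps)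
  ultimately have "norm (w - v) = norm (exp x - 1)" by (simp add: norm_mult)
  also have "\<dots> \<le> exp (norm x) * norm x"
    using Taylor_exp_field[of x 0] by simp
  also have "\<dots> \<le> 3 * norm x"
  proof (intro mult_right_mono)
    have "exp (norm x) \<le> exp 1" using x s by (subst exp_le_cancel_iff) linarith
    also have "\<dots> \<le> 3" by (rule exp_le)
    finally show "exp (norm x) \<le> 3" .
  qed simp
  also have "\<dots> \<le> 6 * norm (w ^ n - 1)" using x by (simp add: s_def)
  finally show ?thesis using \<open>v ^ n = 1\<close> that by blast
qed

lemma norm_power_diff_le:
  fixes z :: complex
  assumes "0 < d"
  shows "norm (z ^ n - of_real d ^ n) \<le> 2 * max (cmod z) d ^ n"
proof -
  have "norm (z ^ n - of_real d ^ n) \<le> norm z ^ n + d ^ n"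
    using assms norm_triangle_ineq4[of "z ^ n" "of_real d ^ n"] by (simp add: norm_power)
  also have "\<dots> \<le> max (cmod z) d ^ n + max (cmod z) d ^ n"
    using assms by (intro add_mono power_mono) auto
  finally show ?thesis by simp
qed

text \<open>Scale to \<open>d = 1\<close>. If \<open>cmod w ^ n \<ge> 2\<close>, the power dominates
  the \<open>1\<close>. Otherwise \<open>max (cmod w) 1 ^ n \<le> 2\<close>, and
  \<open>w ^ n - 1\<close> is either larger than \<open>1/4\<close> in modulus or so small that
  \<open>w\<close> is near a root of unity, where \<open>far\<close> bounds it below by
  \<open>\<rho> / 6\<close>. The factor \<open>1/16\<close> covers all cases.\<close>

lemma norm_power_diff_ge:
  fixes z :: complex
  assumes "0 < d" "n > 0" "0 < \<rho>" "\<rho> \<le> 1"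
    and far: "\<And>v. v ^ n = 1 \<Longrightarrow> \<rho> * d \<le> cmod (z - of_real d * v)"
  shows "\<rho> / 16 * max (cmod z) d ^ n \<le> norm (z ^ n - of_real d ^ n)"
proof -
  define w where "w = z / of_real d"
  have z: "z = of_real d * w" using assms by (simp add: w_def)
  have far': "\<rho> \<le> cmod (w - v)" if "v ^ n = 1" for v
  proof -
    have "z - of_real d * v = of_real d * (w - v)" by (simp add: z algebra_simps)
    then have "cmod (z - of_real d * v) = d * cmod (w - v)"
      using assms(1) by (simp add: norm_mult)
    then show ?thesis using far[OF that] assms(1) by (simp add: mult.commute)
  qed
  have "\<rho> / 16 * max (cmod w) 1 ^ n \<le> norm (w ^ n - 1)"
  proof (cases "cmod w ^ n \<ge> 2")
    case True
    then have "cmod w \<ge> 1" using power_le_one[of "cmod w" n] by (cases "cmod w \<ge> 1") auto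
    then have "max (cmod w) 1 = cmod w" by simp
    moreover have "\<rho> * cmod w ^ n \<le> 1 * cmod w ^ n"
      using assms by (intro mult_right_mono) auto
    moreover have "cmod w ^ n - 1 \<le> norm (w ^ n - 1)"
      using norm_triangle_ineq2[of "w ^ n" 1] by (simp add: norm_power)
    ultimately show ?thesis using True by (simp only: )
  next
    case False
    have m: "max (cmod w) 1 ^ n \<le> 2" using False by (auto simp: max_def)
    have "\<rho> / 16 * max (cmod w) 1 ^ n \<le> \<rho> / 16 * 2" using m assms by (intro mult_left_mono) auto
    also have "\<dots> \<le> norm (w ^ n - 1)"
    proof (cases "norm (w ^ n - 1) \<le> 1/4")
      case True
      then obtain v where "v ^ n = 1" "norm (w - v) \<le> 6 * norm (w ^ n - 1)"
        using near_root_of_unity assms(2) by blast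
      with far'[of v] have "\<rho> \<le> 6 * norm (w ^ n - 1)" by linarith
      then show ?thesis using norm_ge_zero[of "w ^ n - 1"] by linarith
    qed (use assms in simp)
    finally show ?thesis .
  qed
  moreover have "max (cmod z) d = d * max (cmod w) 1"
    using assms(1) by (simp add: z norm_mult max_mult_distrib_left)
  moreover have "norm (z ^ n - of_real d ^ n) = d ^ n * norm (w ^ n - 1)"
  proof -
    have "z ^ n - of_real d ^ n = of_real d ^ n * (w ^ n - 1)"
      by (simp add: z power_mult_distrib algebra_simps)
    then show ?thesis using assms(1) by (simp add: norm_mult norm_power)
  qed
  ultimately show ?thesis
    using assms(1) by (simp add: power_mult_distrib mult.left_commute)
qed

subsection \<open>Pairs of polynomials for finitely many atoms\<close>

text \<open>Pigeonhole over the \<open>N\<^sup>2 + 1\<close> candidates \<open>s * k\<close>: they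
  have spacing \<open>s\<close>, so each difference \<open>y - z\<close> is closer than
  \<open>s / 2\<close> to at most one of them, and there are at most \<open>N\<^sup>2\<close> such
  differences.\<close>

lemma exists_separated_shift:
  fixes Z :: "complex set"
  assumes "finite Z" "card Z \<le> N" "0 < s"
  obtains h :: real where "0 < h" "h \<le> s * real (N\<^sup>2 + 1)"
    "\<And>y z. y \<in> Z \<Longrightarrow> z \<in> Z \<Longrightarrow> s / 2 \<le> cmod (of_real h - (y - z))"
proof (rule ccontr)
  note main = that
  assume contr: "\<not> thesis"
  define K where "K = N\<^sup>2 + 1"
  have "\<exists>x. x \<in> Z \<times> Z \<and> cmod (of_real (s * real k) - (fst x - snd x)) < s / 2" if "k \<in> {1..K}" for k
  proof (rule ccontr)
    assume *: "\<not> ?thesis"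
    show False
    proof (rule contr[THEN notE], rule main[of "s * real k"])
      show "0 < s * real k" using assms(3) that by simp
      have "real k \<le> real K" using that by simp
      then show "s * real k \<le> s * real (N\<^sup>2 + 1)"
        using assms(3) unfolding K_def by (intro mult_left_mono) auto
      fix y z assume "y \<in> Z" "z \<in> Z"
      with * have "\<not> cmod (of_real (s * real k) - (y - z)) < s / 2"
        by (metis SigmaI fst_conv snd_conv)
      then show "s / 2 \<le> cmod (of_real (s * real k) - (y - z))" by linarith
    qed
  qed
  then obtain f where f: "\<And>k. k \<in> {1..K} \<Longrightarrow>
      f k \<in> Z \<times> Z \<and> cmod (of_real (s * real k) - (fst (f k) - snd (f k))) < s / 2"
    by metis
  have "inj_on f {1..K}"
  proof (rule inj_onI)
    fix j k assume j: "j \<in> {1..K}" and k: "k \<in> {1..K}" and eq: "f j = f k"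
    have "dist (of_real (s * real j)) (of_real (s * real k) :: complex) < s"
    proof (rule dist_triangle_half_l)
      show "dist (of_real (s * real j)) (fst (f k) - snd (f k)) < s / 2"
        unfolding dist_norm eq[symmetric] using f[OF j] by blast
      show "dist (of_real (s * real k)) (fst (f k) - snd (f k)) < s / 2"
        unfolding dist_norm using f[OF k] by blast
    qed
    then have "cmod (of_real (s * (real j - real k))) < s"
      by (simp add: dist_norm right_diff_distrib)
    then have "s * \<bar>real j - real k\<bar> < s * 1"
      using assms(3) by (simp only: norm_of_real abs_mult abs_of_pos)
    then have "\<bar>real j - real k\<bar> < 1" using assms(3) by (simp only: mult_less_cancel_left_pos)
    then show "j = k" by linarith
  qed
  then have "card {1..K} \<le> card (Z \<times> Z)"
  proof (rule card_inj_on_le)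
    show "f ` {1..K} \<subseteq> Z \<times> Z" using f by blast
  qed (use assms(1) in auto)
  also have "\<dots> \<le> N * N"
    using assms(2) by (simp add: card_cartesian_product mult_le_mono)
  finally show False by (simp add: K_def power2_eq_square)
qed

text \<open>Each atom contributes one factor to \<open>p\<close>, hence one bounded multiplicative
  loss, whatever its multiplicity. The error is therefore \<open>e * N\<close> from the shift plus a
  term of order \<open>card A * ln N\<close>, and the latter disappears after division by
  \<open>N\<close> when \<open>A\<close> is fixed and \<open>N\<close> grows.\<close>

lemma poly_pair_approx_tlog:
  fixes A :: "complex set" and n :: "complex \<Rightarrow> nat"
  assumes A: "finite A" "A \<noteq> {}" and n: "\<And>a. a \<in> A \<Longrightarrow> n a > 0"
    and d: "0 < d" and e: "0 < e" "e \<le> 1"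
  defines "N \<equiv> \<Sum>a\<in>A. n a"
  obtains p q :: "complex poly" where "degree p = N" "degree q = N"
    "\<And>t. 0 < max (cmod (poly p t)) (cmod (poly q t))"
    "\<And>t. \<bar>(\<Sum>a\<in>A. real (n a) * tlog d (t - a)) - ln (max (cmod (poly p t)) (cmod (poly q t)))\<bar>
        \<le> e * real N + real (card A) * ln (64 * real (N\<^sup>2 + 1) / e)"
proof -
  define p :: "complex poly" where
    "p = (\<Prod>a\<in>A. [:- a, 1:] ^ n a - [:of_real d ^ n a:])"
  \<comment> \<open>Discs of radius \<open>\<rho> * d\<close> around the zeros will be avoided. With
    spacing \<open>4 * \<rho> * d\<close> the pigeonhole shift is at most
    \<open>4 * \<rho> * d * (N\<^sup>2 + 1) = e * d\<close>, which changes \<open>W\<close> by at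
    most \<open>e * N\<close>.\<close>
  define \<rho> where "\<rho> = e / (4 * real (N\<^sup>2 + 1))"
  define m where "m = card A"
  define c where "c = \<rho> / 16"
  define Z where "Z = (\<Union>a\<in>A. (\<lambda>v. a + of_real d * v) ` {v. v ^ n a = 1})"
  define X where "X = (\<lambda>t. \<Prod>a\<in>A. max (cmod (t - a)) d ^ n a)"
  define W where "W = (\<lambda>t. \<Sum>a\<in>A. real (n a) * tlog d (t - a))"
  have deg1: "degree ([:- a, 1:] ^ n a - [:of_real d ^ n a:] :: complex poly) = n a"
      "[:- a, 1:] ^ n a - [:of_real d ^ n a:] \<noteq> (0 :: complex poly)" if "a \<in> A" for a
  proof -
    have "degree ([:- a, 1:] ^ n a + (- [:of_real d ^ n a:]) :: complex poly) = degree ([:- a, 1:] ^ n a :: complex poly)"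
      by (rule degree_add_eq_left) (use n[OF that] in \<open>simp add: degree_linear_power\<close>)
    then show *: "degree ([:- a, 1:] ^ n a - [:of_real d ^ n a:] :: complex poly) = n a"
      by (simp only: diff_conv_add_uminus degree_linear_power)
    show "[:- a, 1:] ^ n a - [:of_real d ^ n a:] \<noteq> (0 :: complex poly)"
      using * n[OF that] by (metis degree_0 less_irrefl)
  qed
  have degp: "degree p = N"
    unfolding p_def N_def using deg1 by (subst degree_prod_sum_eq) auto
  have polyp: "poly p t = (\<Prod>a\<in>A. (t - a) ^ n a - of_real d ^ n a)" for t
    by (simp add: p_def poly_prod)
  have \<rho>: "0 < \<rho>" "\<rho> \<le> 1"
  proof -
    have "1 \<le> 4 * real (N\<^sup>2 + 1)" by simp
    then have "0 < 4 * real (N\<^sup>2 + 1)" "e \<le> 4 * real (N\<^sup>2 + 1)" using e by linarith+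
    then show "0 < \<rho>" "\<rho> \<le> 1" using e by (simp_all only: \<rho>_def zero_less_divide_iff divide_le_eq_1_pos) auto
  qed
  have c: "0 < c" "c \<le> 1" using \<rho> by (auto simp: c_def)
  have Xpos: "X t > 0" for t
    using d by (auto simp: X_def intro!: prod_pos)
  have lnX: "ln (X t) = W t" for t
    unfolding X_def W_def tlog_def using A d
    by (subst ln_prod) (auto simp: ln_realpow)
  have Wd: "\<bar>W (t + h) - W t\<bar> \<le> real N * (cmod h / d)" for t h
  proof -
    have "\<bar>W (t + h) - W t\<bar> = \<bar>\<Sum>a\<in>A. real (n a) * (tlog d (t + h - a) - tlog d (t - a))\<bar>"
      by (simp add: W_def sum_subtractf right_diff_distrib)
    also have "\<dots> \<le> (\<Sum>a\<in>A. \<bar>real (n a) * (tlog d (t + h - a) - tlog d (t - a))\<bar>)"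
      by (rule sum_abs)
    also have "\<dots> \<le> (\<Sum>a\<in>A. real (n a) * (cmod h / d))"
    proof (rule sum_mono)
      fix a
      show "\<bar>real (n a) * (tlog d (t + h - a) - tlog d (t - a))\<bar> \<le> real (n a) * (cmod h / d)"
        using mult_left_mono[OF tlog_diff_le_norm[OF d, of "t + h - a" "t - a"], of "real (n a)"]
        by (simp add: abs_mult)
    qed
    also have "\<dots> = real N * (cmod h / d)" by (simp only: N_def of_nat_sum sum_distrib_right)
    finally show ?thesis .
  qed
  have upper: "cmod (poly p t) \<le> 2 ^ m * X t" for t
  proof -
    have "cmod (poly p t) = (\<Prod>a\<in>A. cmod ((t - a) ^ n a - of_real d ^ n a))"
      by (simp add: polyp prod_norm)
    also have "\<dots> \<le> (\<Prod>a\<in>A. 2 * max (cmod (t - a)) d ^ n a)"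
      using d by (intro prod_mono) (auto intro: norm_power_diff_le)
    also have "\<dots> = 2 ^ m * X t" by (simp add: prod.distrib X_def m_def)
    finally show ?thesis .
  qed
  have lower: "c ^ m * X t \<le> cmod (poly p t)" if t: "\<And>z. z \<in> Z \<Longrightarrow> \<rho> * d \<le> cmod (t - z)" for t
  proof -
    have "c ^ m * X t = (\<Prod>a\<in>A. c * max (cmod (t - a)) d ^ n a)"
      by (simp add: prod.distrib X_def m_def)
    also have "\<dots> \<le> (\<Prod>a\<in>A. cmod ((t - a) ^ n a - of_real d ^ n a))"
    proof (intro prod_mono conjI)
      fix a assume a: "a \<in> A"
      show "c * max (cmod (t - a)) d ^ n a \<le> cmod ((t - a) ^ n a - complex_of_real d ^ n a)"
        unfolding c_def
      proof (rule norm_power_diff_ge)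
        fix v :: complex assume "v ^ n a = 1"
        then show "\<rho> * d \<le> cmod (t - a - of_real d * v)"
          using t[of "a + of_real d * v"] a by (auto simp: Z_def diff_diff_eq)
      qed (use n a d \<rho> in auto)
    qed (use c d in auto)
    also have "\<dots> = cmod (poly p t)" by (simp add: polyp prod_norm)
    finally show ?thesis .
  qed
  have rts: "finite {v::complex. v ^ n a = 1}" "card {v::complex. v ^ n a = 1} \<le> n a" if "a \<in> A" for a
    using n[OF that] by (auto intro!: finite_roots_unity card_roots_unity)
  have "finite Z" using A rts by (auto simp: Z_def)
  moreover have "card Z \<le> N"
    unfolding Z_def N_def using A rts
    by (intro order.trans[OF card_UN_le] sum_mono order.trans[OF card_image_le]) auto
  \<comment> \<open>The spacing is \<open>4 * \<rho> * d\<close> so that the separation obtained,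
    half of it, is twice the radius of the discs.\<close>
  moreover have "0 < 4 * \<rho> * d" using \<rho> d by simp
  ultimately obtain h :: real where h: "0 < h" "h \<le> 4 * \<rho> * d * real (N\<^sup>2 + 1)"
      and sep: "\<And>y z. y \<in> Z \<Longrightarrow> z \<in> Z \<Longrightarrow> 4 * \<rho> * d / 2 \<le> cmod (of_real h - (y - z))"
    by (rule exists_separated_shift) blast
  have hd: "h / d \<le> e"
  proof -
    have "\<rho> * (4 * real (N\<^sup>2 + 1)) = e"
    proof -
      have "1 \<le> 4 * real (N\<^sup>2 + 1)" by simp
      then have "4 * real (N\<^sup>2 + 1) \<noteq> 0" by linarith
      then show ?thesis unfolding \<rho>_def by (rule nonzero_eq_divide_eq[THEN iffD1, OF _ refl])
    qed
    then have "4 * \<rho> * d * real (N\<^sup>2 + 1) = e * d" by (metis mult.assoc mult.commute)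
    with h(2) have "h \<le> e * d" by (simp only:)
    with d show ?thesis by (simp add: divide_le_eq)
  qed
  define q where "q = p \<circ>\<^sub>p [:of_real h, 1:]"
  have degq: "degree q = N" by (simp add: q_def degp degree_pcompose)
  have polyq: "poly q t = poly p (t + of_real h)" for t
    by (simp add: q_def poly_pcompose add.commute)
  define Y where "Y = (\<lambda>t. max (cmod (poly p t)) (cmod (poly q t)))"
  have W_shift: "\<bar>W (t + of_real h) - W t\<bar> \<le> e * real N" for t
    using Wd[of t "of_real h"] mult_left_mono[OF hd, of "real N"] h(1) by (simp add: mult.commute)
  have X_shift: "X (t + of_real h) \<le> exp (e * real N) * X t" 
    "exp (- (e * real N)) * X t \<le> X (t + of_real h)" for t
  proof -
    have *: "X t = exp (W t)" for t using lnX[of t] Xpos[of t] by (metis exp_ln)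
    show "X (t + of_real h) \<le> exp (e * real N) * X t"
      "exp (- (e * real N)) * X t \<le> X (t + of_real h)"
      using W_shift[of t] by (auto simp: * exp_add[symmetric])
  qed
  have Yupper: "Y t \<le> 2 ^ m * (exp (e * real N) * X t)" for t
  proof -
    have "1 * X t \<le> exp (e * real N) * X t"
      using e Xpos[of t] by (intro mult_right_mono) auto
    then have "cmod (poly p t) \<le> 2 ^ m * (exp (e * real N) * X t)"
      by (intro order_trans[OF upper mult_left_mono]) auto
    moreover have "cmod (poly q t) \<le> 2 ^ m * (exp (e * real N) * X t)"
      unfolding polyq by (intro order_trans[OF upper mult_left_mono] X_shift) auto
    ultimately show ?thesis by (simp add: Y_def)
  qed
  have Ylower: "c ^ m * (exp (- (e * real N)) * X t) \<le> Y t" for t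
  proof (cases "\<forall>z\<in>Z. \<rho> * d \<le> cmod (t - z)")
    case True
    have "exp (- (e * real N)) * X t \<le> 1 * X t"
      using e Xpos[of t] by (intro mult_right_mono) auto
    then have "c ^ m * (exp (- (e * real N)) * X t) \<le> c ^ m * X t"
      using c by (intro mult_left_mono) auto
    also have "\<dots> \<le> cmod (poly p t)" using True by (intro lower) auto
    finally show ?thesis by (simp add: Y_def)
  next
    case False
    then obtain z where z: "z \<in> Z" "cmod (t - z) < \<rho> * d" by auto
    \<comment> \<open>The point \<open>t + h\<close> is within \<open>\<rho> * d\<close> of
      \<open>z + h\<close>, which is at least \<open>2 * \<rho> * d\<close> away from every zero in
      \<open>Z\<close>. So where \<open>p\<close> may be too small, \<open>q\<close> is not.\<close>
    have "\<rho> * d \<le> cmod (t + of_real h - y)" if "y \<in> Z" for y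
    proof -
      have "of_real h - (y - z) = (t + of_real h - y) - (t - z)" by simp
      then have "cmod (of_real h - (y - z)) \<le> cmod (t + of_real h - y) + cmod (t - z)"
        by (metis norm_triangle_ineq4)
      then show ?thesis using sep[OF that z(1)] z(2) by simp
    qed
    then have "c ^ m * X (t + of_real h) \<le> cmod (poly q t)"
      unfolding polyq by (rule lower)
    then have "c ^ m * (exp (- (e * real N)) * X t) \<le> cmod (poly q t)"
      by (rule order_trans[OF mult_left_mono[OF X_shift(2)], rotated]) (use c in auto)
    then show ?thesis by (simp add: Y_def)
  qed
  have Ypos: "0 < Y t" for t
    using Ylower[of t] c Xpos[of t] by (smt (verit) exp_gt_zero mult_pos_pos zero_less_power)
  have lnc: "ln (1 / c) = ln (64 * real (N\<^sup>2 + 1) / e)"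
    by (simp add: c_def \<rho>_def)
  have "2 \<le> 1 / c" using c \<rho> by (simp add: c_def field_simps)
  then have ln2c: "ln 2 \<le> ln (1 / c)" using c by (subst ln_le_cancel_iff) auto
  have "\<bar>W t - ln (Y t)\<bar> \<le> e * real N + real m * ln (1 / c)" for t
  proof -
    have "ln (Y t) \<le> ln (2 ^ m * (exp (e * real N) * X t))"
      using Yupper[of t] Ypos[of t] by (subst ln_le_cancel_iff) (auto simp: Xpos)
    also have "\<dots> = real m * ln 2 + (e * real N + W t)"
      using Xpos[of t] by (simp add: ln_mult_pos ln_realpow lnX)
    also have "\<dots> \<le> real m * ln (1 / c) + (e * real N + W t)"
      using ln2c by (intro add_right_mono mult_left_mono) auto
    finally have 1: "ln (Y t) \<le> real m * ln (1 / c) + (e * real N + W t)" .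
    have "real m * ln c + (- (e * real N) + W t) = ln (c ^ m * (exp (- (e * real N)) * X t))"
      using Xpos[of t] c by (simp add: ln_mult_pos ln_realpow lnX)
    also have "\<dots> \<le> ln (Y t)"
      using Ylower[of t] Ypos[of t] c by (subst ln_le_cancel_iff) (auto simp: Xpos)
    finally have 2: "W t - ln (Y t) \<le> e * real N - real m * ln c" by simp
    have "ln (1 / c) = - ln c" using c by (simp add: ln_div)
    with 1 2 show ?thesis by (simp add: abs_le_iff)
  qed
  with degp degq Ypos show ?thesis
    unfolding Y_def W_def lnc m_def by (intro that[of p q]) auto
qed

subsection \<open>Discretization of the measure\<close>

lemma borel_measurable_tlog [measurable]: "tlog d \<in> borel_measurable borel"
  unfolding tlog_def by measurable

lemma ln_add_one_scale_le:
  fixes x c :: real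
  assumes "0 \<le> x" "0 \<le> c"
  shows "ln (1 + c * x) \<le> ln (1 + c) + ln (1 + x)"
proof -
  have "1 + c * x \<le> (1 + c) * (1 + x)" using assms by (simp add: algebra_simps)
  then have "ln (1 + c * x) \<le> ln ((1 + c) * (1 + x))"
    using assms by (subst ln_le_cancel_iff) (auto intro!: mult_pos_pos add_pos_nonneg)
  also have "\<dots> = ln (1 + c) + ln (1 + x)" using assms by (intro ln_mult_pos) auto
  finally show ?thesis .
qed

text \<open>Only the tail of the measure is controlled. Truncated kernels are bounded below, so mass
  near a singularity does no harm at this stage.\<close>

locale log_moment = prob_space \<mu> for \<mu> :: "complex measure" +
  assumes sets_eq [measurable_cong, simp]: "sets \<mu> = sets borel"
    and int_log: "integrable \<mu> (\<lambda>z. ln (1 + cmod z))"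
begin

lemma space_eq [simp]: "space \<mu> = UNIV"
  using sets_eq_imp_space_eq[OF sets_eq] by simp

lemma integrable_ln_scale:
  assumes "0 \<le> c"
  shows "integrable \<mu> (\<lambda>z. ln (1 + c * cmod z))"
proof (rule Bochner_Integration.integrable_bound)
  show "integrable \<mu> (\<lambda>z. ln (1 + c) + ln (1 + cmod z))" using int_log by simp
  show "AE z in \<mu>. norm (ln (1 + c * cmod z)) \<le> norm (ln (1 + c) + ln (1 + cmod z))"
    using assms ln_add_one_scale_le[of "cmod _" c] by (intro AE_I2) (auto simp: abs_of_nonneg)
qed measurable

text \<open>The map \<open>f\<close> lets one statement serve both the identity and the simple
  functions approximating it, which satisfy the same growth bound.\<close>

lemma integrable_tlog:
  assumes "0 < d" and [measurable]: "f \<in> borel_measurable borel" and "\<And>z. cmod (f z) \<le> 2 * cmod z"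
  shows "integrable \<mu> (\<lambda>z. tlog d (t - f z))"
proof (rule Bochner_Integration.integrable_bound)
  show "integrable \<mu> (\<lambda>z. \<bar>tlog d t\<bar> + ln (1 + (2 / d) * cmod z))"
    using integrable_ln_scale[of "2 / d"] assms(1) by simp
  show "AE z in \<mu>. norm (tlog d (t - f z)) \<le> norm (\<bar>tlog d t\<bar> + ln (1 + (2 / d) * cmod z))"
  proof (rule AE_I2)
    fix z
    have "ln (1 + cmod (f z) / d) \<le> ln (1 + (2 / d) * cmod z)"
      using assms(1) assms(3)[of z] by (subst ln_le_cancel_iff) (auto intro!: add_pos_nonneg simp: divide_right_mono)
    with tlog_diff_le[OF assms(1), of "t - f z" t] assms(1)
    show "norm (tlog d (t - f z)) \<le> norm (\<bar>tlog d t\<bar> + ln (1 + (2 / d) * cmod z))"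
      by simp
  qed
qed measurable

text \<open>Take simple \<open>F i\<close> converging pointwise to the identity with
  \<open>cmod (F i x) \<le> 2 * cmod x\<close>. The kernels differ by at most
  \<open>ln (1 + cmod (x - F i x) / d)\<close>, which does not involve \<open>t\<close>, so one
  application of dominated convergence gives an estimate uniform in \<open>t\<close>.\<close>

lemma approx_tlog_by_simple_function:
  assumes d: "0 < d" and e: "0 < e"
  obtains F where "simple_function \<mu> F"
    "\<And>t. \<bar>(\<integral>z. tlog d (t - z) \<partial>\<mu>) - (\<integral>z. tlog d (t - F z) \<partial>\<mu>)\<bar> < e"
proof -
  have "\<exists>F. (\<forall>i. simple_function \<mu> (F i)) \<and> (\<forall>x\<in>space \<mu>. (\<lambda>i. F i x) \<longlonglongrightarrow> x) \<and>
    (\<forall>i. \<forall>x\<in>space \<mu>. dist (F i x) 0 \<le> 2 * dist x (0::complex))"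
    by (rule borel_measurable_implies_sequence_metric) measurable
  then obtain F where F: "\<And>i. simple_function \<mu> (F i)" "\<And>x. (\<lambda>i. F i x) \<longlonglongrightarrow> x"
      "\<And>i x. cmod (F i x) \<le> 2 * cmod x"
    by auto
  have Fm [measurable]: "F i \<in> borel_measurable borel" for i
    using borel_measurable_simple_function[OF F(1)[of i]] by (simp cong: measurable_cong_sets)
  have bnd: "ln (1 + cmod (x - F i x) / d) \<le> ln (1 + 3 / d * cmod x)" for x i
  proof -
    have "cmod (x - F i x) \<le> 3 * cmod x"
      using norm_triangle_ineq4[of x "F i x"] F(3)[of i x] by linarith
    then show ?thesis
      using d by (subst ln_le_cancel_iff) (auto intro!: add_pos_nonneg simp: divide_right_mono)
  qed
  have w: "integrable \<mu> (\<lambda>x. ln (1 + 3 / d * cmod x))"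
    using d by (intro integrable_ln_scale) auto
  have lim: "(\<lambda>i. \<integral>x. ln (1 + cmod (x - F i x) / d) \<partial>\<mu>) \<longlonglongrightarrow> (\<integral>x. 0 \<partial>\<mu>)"
  proof (rule integral_dominated_convergence[OF _ _ w])
    show "AE x in \<mu>. (\<lambda>i. ln (1 + cmod (x - F i x) / d)) \<longlonglongrightarrow> 0"
    proof (rule AE_I2)
      fix x
      have "(\<lambda>i. ln (1 + cmod (x - F i x) / d)) \<longlonglongrightarrow> ln (1 + cmod (x - x) / d)"
        using d by (intro tendsto_intros F(2)) auto
      then show "(\<lambda>i. ln (1 + cmod (x - F i x) / d)) \<longlonglongrightarrow> 0" by simp
    qed
    show "AE x in \<mu>. norm (ln (1 + cmod (x - F i x) / d)) \<le> ln (1 + 3 / d * cmod x)" for i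
      using bnd d by (intro AE_I2) auto
  qed measurable
  then have "(\<lambda>i. \<integral>x. ln (1 + cmod (x - F i x) / d) \<partial>\<mu>) \<longlonglongrightarrow> 0" by simp
  then have "\<forall>\<^sub>F i in sequentially. (\<integral>x. ln (1 + cmod (x - F i x) / d) \<partial>\<mu>) < e"
    using e by (rule order_tendstoD)
  then obtain i where i: "(\<integral>x. ln (1 + cmod (x - F i x) / d) \<partial>\<mu>) < e"
    by (meson eventually_happens trivial_limit_sequentially)
  have "\<bar>(\<integral>z. tlog d (t - z) \<partial>\<mu>) - (\<integral>z. tlog d (t - F i z) \<partial>\<mu>)\<bar> < e" for t
  proof -
    have 1: "integrable \<mu> (\<lambda>z. tlog d (t - z))" "integrable \<mu> (\<lambda>z. tlog d (t - F i z))"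
      using d F(3) by (auto intro!: integrable_tlog)
    have "\<bar>(\<integral>z. tlog d (t - z) \<partial>\<mu>) - (\<integral>z. tlog d (t - F i z) \<partial>\<mu>)\<bar>
        = \<bar>\<integral>z. tlog d (t - z) - tlog d (t - F i z) \<partial>\<mu>\<bar>"
      using 1 by simp
    also have "\<dots> \<le> (\<integral>x. ln (1 + cmod (x - F i x) / d) \<partial>\<mu>)"
    proof (rule integral_abs_bound_integral)
      show "integrable \<mu> (\<lambda>x. ln (1 + cmod (x - F i x) / d))"
        by (rule Bochner_Integration.integrable_bound[OF w]) (use bnd[of _ i] d in auto)
    qed (use 1 tlog_diff_le[OF d, of "t - _" "t - F i _"] in \<open>auto simp: norm_minus_commute\<close>)
    finally show ?thesis using i by linarith
  qed
  with F(1)[of i] show ?thesis by (rule that)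
qed

lemma integral_simple_function_comp:
  fixes g :: "complex \<Rightarrow> real"
  assumes "simple_function \<mu> F"
  shows "(\<integral>z. g (F z) \<partial>\<mu>) = (\<Sum>a\<in>range F. prob (F -` {a}) * g a)"
proof -
  have fin: "finite (range F)" and ms: "\<And>a. a \<in> range F \<Longrightarrow> F -` {a} \<in> sets \<mu>"
    using assms by (auto simp: simple_function_def)
  have "g (F z) = (\<Sum>a\<in>range F. indicat_real (F -` {a}) z * g a)" for z
  proof -
    have "(\<Sum>a\<in>range F. indicat_real (F -` {a}) z * g a) = (\<Sum>a\<in>range F. if F z = a then g a else 0)"
      by (intro sum.cong) auto
    also have "\<dots> = g (F z)" using fin by simp
    finally show ?thesis by simp
  qed
  then have "(\<integral>z. g (F z) \<partial>\<mu>) = (\<integral>z. (\<Sum>a\<in>range F. indicat_real (F -` {a}) z * g a) \<partial>\<mu>)"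
    by simp
  also have "\<dots> = (\<Sum>a\<in>range F. \<integral>z. indicat_real (F -` {a}) z * g a \<partial>\<mu>)"
    using ms by (intro Bochner_Integration.integral_sum integrable_mult_left) (auto simp: integrable_indicator_iff emeasure_eq_measure)
  also have "\<dots> = (\<Sum>a\<in>range F. prob (F -` {a}) * g a)"
    using ms by simp
  finally show ?thesis .
qed

text \<open>Three errors below \<open>e / 3\<close> are added: replacing the measure by the atoms of
  a simple function, rounding their masses to rationals \<open>n k a / N k\<close>, and passing from
  the atoms to a pair of polynomials.\<close>

lemma poly_pair_approx_smoothed_potential:
  assumes d: "0 < d" and e: "0 < e"
  obtains N :: nat and p q :: "complex poly" where "0 < N" "degree p = N" "degree q = N"
    "\<And>t. 0 < max (cmod (poly p t)) (cmod (poly q t))"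
    "\<And>t. \<bar>(\<integral>z. tlog d (t - z) \<partial>\<mu>) - 1 / real N * ln (max (cmod (poly p t)) (cmod (poly q t)))\<bar> < e"
proof -
  obtain F where F: "simple_function \<mu> F"
      "\<And>t. \<bar>(\<integral>z. tlog d (t - z) \<partial>\<mu>) - (\<integral>z. tlog d (t - F z) \<partial>\<mu>)\<bar> < e / 3"
    using approx_tlog_by_simple_function[OF d, of "e / 3"] e by auto
  define A where "A = range F"
  have A: "finite A" "A \<noteq> {}" using F(1) by (auto simp: A_def simple_function_def)
  define m where "m = (\<lambda>a. prob (F -` {a}))"
  have m0: "0 \<le> m a" for a by (simp add: m_def)
  have Fint: "(\<integral>z. g (F z) \<partial>\<mu>) = (\<Sum>a\<in>A. m a * g a)" for g :: "complex \<Rightarrow> real"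
    unfolding A_def m_def by (rule integral_simple_function_comp[OF F(1)])
  have sum_m: "(\<Sum>a\<in>A. m a) = 1"
    using Fint[of "\<lambda>_. 1"] prob_space by simp
  \<comment> \<open>Strictly less than \<open>e / 3\<close>, to leave room for the logarithmic term;
    the cap \<open>1\<close> is demanded by \<open>poly_pair_approx_tlog\<close>.\<close>
  define e' where "e' = min 1 (e / 6)"
  have e': "0 < e'" "e' \<le> 1" "e' < e / 3" using e by (auto simp: e'_def min_def)
  \<comment> \<open>Adding \<open>1\<close> after rounding down keeps every multiplicity positive,
    even at atoms of mass zero, and does not affect the limit of \<open>n k a / k\<close>.\<close>
  define n where "n = (\<lambda>k a. nat \<lfloor>real k * m a\<rfloor> + 1)"
  define N where "N = (\<lambda>k. \<Sum>a\<in>A. n k a)"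
  have n_bd: "real k * m a \<le> real (n k a)" "real (n k a) \<le> real k * m a + 1" for k a
  proof -
    have "0 \<le> real k * m a" using m0 by simp
    then have "real (n k a) = of_int \<lfloor>real k * m a\<rfloor> + 1" by (simp add: n_def)
    then show "real k * m a \<le> real (n k a)" "real (n k a) \<le> real k * m a + 1" by linarith+
  qed
  have n_lim: "(\<lambda>k. real (n k a) / real k) \<longlonglongrightarrow> m a" for a
  proof (rule tendsto_sandwich)
    show "(\<lambda>k::nat. m a) \<longlonglongrightarrow> m a" by simp
    show "(\<lambda>k. m a + 1 / real k) \<longlonglongrightarrow> m a" by real_asymp
    show "\<forall>\<^sub>F k in sequentially. m a \<le> real (n k a) / real k"
      using eventually_gt_at_top[of 0] by eventually_elim (use n_bd in \<open>simp add: field_simps\<close>)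
    show "\<forall>\<^sub>F k in sequentially. real (n k a) / real k \<le> m a + 1 / real k"
      using eventually_gt_at_top[of 0] by eventually_elim (use n_bd in \<open>simp add: field_simps\<close>)
  qed
  have N_lim: "(\<lambda>k. real (N k) / real k) \<longlonglongrightarrow> 1"
  proof -
    have "(\<lambda>k. \<Sum>a\<in>A. real (n k a) / real k) \<longlonglongrightarrow> (\<Sum>a\<in>A. m a)"
      by (intro tendsto_sum n_lim)
    then show ?thesis by (simp add: N_def sum_divide_distrib sum_m)
  qed
  have N_ge: "k \<le> N k" for k
  proof -
    have "real k = (\<Sum>a\<in>A. real k * m a)" by (simp add: sum_distrib_left[symmetric] sum_m)
    also have "\<dots> \<le> (\<Sum>a\<in>A. real (n k a))" by (intro sum_mono n_bd)
    finally show ?thesis by (simp add: N_def flip: of_nat_sum)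
  qed
  have quot_lim: "(\<lambda>k. real (n k a) / real (N k)) \<longlonglongrightarrow> m a" for a
  proof (rule Lim_transform_eventually)
    show "(\<lambda>k. (real (n k a) / real k) / (real (N k) / real k)) \<longlonglongrightarrow> m a"
      using tendsto_divide[OF n_lim N_lim] by simp
    show "\<forall>\<^sub>F k in sequentially. (real (n k a) / real k) / (real (N k) / real k) = real (n k a) / real (N k)"
      using eventually_gt_at_top[of 0] by eventually_elim simp
  qed
  have "(\<lambda>k. \<Sum>a\<in>A. \<bar>m a - real (n k a) / real (N k)\<bar> * ln (1 + cmod a / d))
      \<longlonglongrightarrow> (\<Sum>a\<in>A. \<bar>m a - m a\<bar> * ln (1 + cmod a / d))"
    by (intro tendsto_intros quot_lim)
  then have "(\<lambda>k. \<Sum>a\<in>A. \<bar>m a - real (n k a) / real (N k)\<bar> * ln (1 + cmod a / d)) \<longlonglongrightarrow> 0"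
    by simp
  then have ev1: "\<forall>\<^sub>F k in sequentially. (\<Sum>a\<in>A. \<bar>m a - real (n k a) / real (N k)\<bar> * ln (1 + cmod a / d)) < e / 3"
    by (rule order_tendstoD) (use e in simp)
  \<comment> \<open>The set \<open>A\<close> was fixed before \<open>k\<close>, so the term from the
    atoms is of order \<open>ln x / x\<close>.\<close>
  have "((\<lambda>x. e' + real (card A) * ln (64 * (x ^ 2 + 1) / e') / x) \<longlongrightarrow> e') at_top"
    using e'(1) by real_asymp
  moreover have "filterlim (\<lambda>k. real (N k)) at_top sequentially"
    using N_ge by (intro filterlim_at_top_mono[OF filterlim_real_sequentially] always_eventually) auto
  ultimately have "(\<lambda>k. e' + real (card A) * ln (64 * (real (N k) ^ 2 + 1) / e') / real (N k)) \<longlonglongrightarrow> e'"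
    by (rule filterlim_compose)
  then have ev2: "\<forall>\<^sub>F k in sequentially. e' + real (card A) * ln (64 * (real (N k) ^ 2 + 1) / e') / real (N k) < e / 3"
    by (rule order_tendstoD) (use e' in simp)
  obtain k where k: "0 < k"
      "(\<Sum>a\<in>A. \<bar>m a - real (n k a) / real (N k)\<bar> * ln (1 + cmod a / d)) < e / 3"
      "e' + real (card A) * ln (64 * (real (N k) ^ 2 + 1) / e') / real (N k) < e / 3"
    using eventually_happens[OF eventually_conj[OF eventually_gt_at_top[of 0] eventually_conj[OF ev1 ev2]]]
    by auto
  have Npos: "0 < N k" using N_ge[of k] k(1) by linarith
  have npos: "0 < n k a" for a by (simp add: n_def)
  obtain p q where pq: "degree p = N k" "degree q = N k"
    "\<And>t. 0 < max (cmod (poly p t)) (cmod (poly q t))"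
    "\<And>t. \<bar>(\<Sum>a\<in>A. real (n k a) * tlog d (t - a)) - ln (max (cmod (poly p t)) (cmod (poly q t)))\<bar>
        \<le> e' * real (N k) + real (card A) * ln (64 * real ((N k)\<^sup>2 + 1) / e')"
    using poly_pair_approx_tlog[where n = "n k", OF A npos d e'(1,2)] unfolding N_def by blast
  have "\<bar>(\<integral>z. tlog d (t - z) \<partial>\<mu>) - 1 / real (N k) * ln (max (cmod (poly p t)) (cmod (poly q t)))\<bar> < e" for t
  proof -
    define W where "W = (\<Sum>a\<in>A. real (n k a) * tlog d (t - a))"
    define Y where "Y = ln (max (cmod (poly p t)) (cmod (poly q t)))"
    have "\<bar>1 / real (N k) * W - 1 / real (N k) * Y\<bar> = \<bar>W - Y\<bar> / real (N k)"
      by (simp add: abs_divide flip: diff_divide_distrib)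
    also have "\<dots> \<le> (e' * real (N k) + real (card A) * ln (64 * real ((N k)\<^sup>2 + 1) / e')) / real (N k)"
      unfolding W_def Y_def by (intro divide_right_mono pq(4)) auto
    also have "\<dots> < e / 3"
      using k(3) Npos by (simp add: add_divide_distrib add.commute)
    finally have 3: "\<bar>1 / real (N k) * W - 1 / real (N k) * Y\<bar> < e / 3" .
    \<comment> \<open>Both systems of weights have total mass \<open>1\<close>. Hence
      \<open>tlog d t\<close> can be subtracted from every kernel value, and what remains is bounded
      uniformly in \<open>t\<close>, unlike \<open>tlog d (t - a)\<close> itself.\<close>
    have z: "(\<Sum>a\<in>A. m a - real (n k a) / real (N k)) = 0"
    proof -
      have "(\<Sum>a\<in>A. real (n k a) / real (N k)) = real (N k) / real (N k)"
        unfolding sum_divide_distrib[symmetric] by (simp add: N_def)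
      then show ?thesis using Npos by (simp add: sum_subtractf sum_m)
    qed
    have "(\<integral>z. tlog d (t - F z) \<partial>\<mu>) - 1 / real (N k) * W
        = (\<Sum>a\<in>A. (m a - real (n k a) / real (N k)) * tlog d (t - a))"
      by (simp add: Fint[of "\<lambda>w. tlog d (t - w)"] W_def sum_divide_distrib sum_subtractf left_diff_distrib)
    also have "\<dots> = (\<Sum>a\<in>A. (m a - real (n k a) / real (N k)) * tlog d (t - a)) -
        (\<Sum>a\<in>A. m a - real (n k a) / real (N k)) * tlog d t"
      by (simp add: z)
    also have "\<dots> = (\<Sum>a\<in>A. (m a - real (n k a) / real (N k)) * (tlog d (t - a) - tlog d t))"
      by (subst sum_distrib_right) (simp only: right_diff_distrib sum_subtractf)
    finally have "\<bar>(\<integral>z. tlog d (t - F z) \<partial>\<mu>) - 1 / real (N k) * W\<bar>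
        \<le> (\<Sum>a\<in>A. \<bar>(m a - real (n k a) / real (N k)) * (tlog d (t - a) - tlog d t)\<bar>)"
      by (simp only: sum_abs)
    also have "\<dots> \<le> (\<Sum>a\<in>A. \<bar>m a - real (n k a) / real (N k)\<bar> * ln (1 + cmod a / d))"
      unfolding abs_mult
    proof (intro sum_mono mult_left_mono)
      fix a show "\<bar>tlog d (t - a) - tlog d t\<bar> \<le> ln (1 + cmod a / d)"
        using tlog_diff_le[OF d, of "t - a" t] by simp
    qed simp
    finally have 2: "\<bar>(\<integral>z. tlog d (t - F z) \<partial>\<mu>) - 1 / real (N k) * W\<bar> < e / 3"
      using k(2) by linarith
    from 2 3 F(2)[of t] show ?thesis unfolding Y_def[symmetric] by linarith
  qed
  with Npos pq(1-3) show ?thesis by (rule that)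
qed

end

subsection \<open>Uniform smallness of the truncation gap\<close>

lemma tlog_mono: "0 < d \<Longrightarrow> d \<le> d' \<Longrightarrow> tlog d z \<le> tlog d' z"
  unfolding tlog_def by (subst ln_le_cancel_iff) auto

lemma ln_le_tlog: "z \<noteq> 0 \<Longrightarrow> 0 < d \<Longrightarrow> ln (cmod z) \<le> tlog d z"
  unfolding tlog_def by (subst ln_le_cancel_iff) auto

lemma tlog_eq_ln: "d \<le> cmod z \<Longrightarrow> tlog d z = ln (cmod z)"
  by (simp add: tlog_def max_def)

text \<open>Both arguments have modulus at least \<open>cmod t / 2 \<ge> 1\<close>, so the
  truncation level can be raised from \<open>1\<close> to \<open>cmod t / 2\<close> without changing
  either value. This improves the Lipschitz constant to \<open>2 / cmod t\<close>.\<close>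

lemma tlog_one_diff_le_at_infinity:
  assumes "2 \<le> cmod t" "2 * cmod z \<le> cmod t"
  shows "\<bar>tlog 1 (t - z) - tlog 1 t\<bar> \<le> 2 * cmod z / cmod t"
proof -
  define r where "r = cmod t / 2"
  have "r \<le> cmod (t - z)" using norm_triangle_ineq2[of t z] assms by (simp add: r_def)
  moreover have "1 \<le> r" using assms by (simp add: r_def)
  moreover have "r \<le> cmod t" by (simp add: r_def)
  ultimately have "tlog 1 (t - z) = tlog r (t - z)" "tlog 1 t = tlog r t"
    by (simp_all add: tlog_eq_ln)
  then show ?thesis
    using tlog_diff_le_norm[of r "t - z" t] \<open>1 \<le> r\<close>
    by (cases "t = 0") (auto simp: r_def mult.commute)
qed

text \<open>The majorant depends on \<open>Re w\<close> only, ready for integration along horizontal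
  lines. It comes from \<open>ln y \<le> y\<close> at
  \<open>y = \<bar>Re w\<bar> powr (-1/2)\<close>. The case \<open>Re w = 0\<close> is excluded
  because \<open>0 powr (-1/2) = 0\<close> would make the bound false.\<close>

lemma tlog_one_minus_ln_le:
  assumes "w \<noteq> 0" "Re w \<noteq> 0"
  shows "tlog 1 w - ln (cmod w) \<le> indicat_real {0..1} \<bar>Re w\<bar> * (2 * \<bar>Re w\<bar> powr (-1/2))"
proof (cases "cmod w \<le> 1")
  case True
  define x where "x = \<bar>Re w\<bar>"
  have x: "0 < x" "x \<le> cmod w" "x \<le> 1"
    using assms True abs_Re_le_cmod[of w] by (auto simp: x_def)
  have "tlog 1 w - ln (cmod w) = - ln (cmod w)" using True by (simp add: tlog_def max_def)
  also have "\<dots> \<le> - ln x"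
    using x ln_le_cancel_iff[of x "cmod w"] by linarith
  also have "\<dots> = 2 * ln (x powr (-1/2))" using x by (simp add: ln_powr)
  also have "\<dots> \<le> 2 * x powr (-1/2)"
    using ln_bound[of "x powr (-1/2)"] x by simp
  finally show ?thesis using x by (simp add: x_def)
next
  case False
  then show ?thesis by (simp add: tlog_eq_ln)
qed

lemma nn_integral_inverse_sqrt:
  "(\<integral>\<^sup>+x. ennreal (indicat_real {0..1} x * (2 * x powr (-1/2))) \<partial>lborel) = 4"
proof -
  have "((\<lambda>x::real. x powr (-1/2)) has_integral (1 powr (-1/2 + 1) / (-1/2 + 1))) {0..1}"
    by (rule has_integral_powr_from_0) auto
  then have "((\<lambda>x::real. 2 * x powr (-1/2)) has_integral 2 * 2) {0..1}"
    by (intro has_integral_mult_right) simp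
  then have "((\<lambda>x. indicat_real {0..1} x * (2 * x powr (-1/2))) has_integral 4) UNIV"
    unfolding has_integral_restrict_UNIV[symmetric, of _ _ "{0..1}"]
    by (simp add: indicator_def if_distrib[of "\<lambda>c. c * _"] of_bool_def cong: if_cong)
  then have "(\<integral>\<^sup>+x. ennreal (indicat_real {0..1} x * (2 * x powr (-1/2))) \<partial>lborel) = ennreal 4"
    by (intro nn_integral_has_integral_lborel) auto
  then show ?thesis by simp
qed

text \<open>What matters is that the bound does not depend on \<open>c\<close>. The value at
  \<open>\<bar>c + s\<bar>\<close> is at most the sum of the values at \<open>c + s\<close> and
  \<open>- c - s\<close>, and each of these integrates to \<open>4\<close>.\<close>

lemma nn_integral_abs_inverse_sqrt_shift_le:
  fixes c :: real
  shows "(\<integral>\<^sup>+s. ennreal (indicat_real {0..1} \<bar>c + s\<bar> * (2 * \<bar>c + s\<bar> powr (-1/2))) \<partial>lborel) \<le> 8"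
proof -
  let ?h = "\<lambda>x. ennreal (indicat_real {0..1} x * (2 * x powr (-1/2)))"
  have "(\<integral>\<^sup>+s. ?h \<bar>c + s\<bar> \<partial>lborel) \<le> (\<integral>\<^sup>+s. ?h (c + 1 * s) + ?h (- c + (- 1) * s) \<partial>lborel)"
    by (intro nn_integral_mono) (auto simp: abs_if)
  also have "\<dots> = (\<integral>\<^sup>+s. ?h (c + 1 * s) \<partial>lborel) + (\<integral>\<^sup>+s. ?h (- c + (- 1) * s) \<partial>lborel)"
    by (intro nn_integral_add) measurable
  also have "(\<integral>\<^sup>+s. ?h (c + 1 * s) \<partial>lborel) = 4"
    using nn_integral_real_affine[of ?h 1 c] nn_integral_inverse_sqrt by simp
  also have "(\<integral>\<^sup>+s. ?h (- c + (- 1) * s) \<partial>lborel) = 4"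
    using nn_integral_real_affine[of ?h "-1" "-c"] nn_integral_inverse_sqrt by simp
  finally show ?thesis by simp
qed

text \<open>To be instantiated with \<open>V\<close> plus a constant. \<open>AE_neq\<close> says
  that the measure has no atoms, so the convention \<open>ln 0 = 0\<close> does not influence the
  integrals. The limit \<open>L\<close> is arbitrary here and turns out to be
  \<open>0\<close>.\<close>

locale cont_potential = log_moment +
  fixes U :: "complex \<Rightarrow> real" and L :: real
  assumes int_ln: "\<And>t. integrable \<mu> (\<lambda>z. ln (cmod (t - z)))"
    and AE_neq: "\<And>t. AE z in \<mu>. t - z \<noteq> 0"
    and U_eq: "\<And>t. U t = (\<integral>z. ln (cmod (t - z)) \<partial>\<mu>)"
    and cont_U: "continuous_on UNIV U"
    and lim_U: "((\<lambda>t. U t - ln (cmod t)) \<longlongrightarrow> L) at_infinity"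
begin

section \<open>The truncation gap: sign, monotonicity, continuity, pointwise limit\<close>

definition gap :: "real \<Rightarrow> complex \<Rightarrow> real" where
  "gap d t = (\<integral>z. tlog d (t - z) \<partial>\<mu>) - U t"

lemma integrable_tlog_diff: "0 < d \<Longrightarrow> integrable \<mu> (\<lambda>z. tlog d (t - z))"
  using integrable_tlog[of d "\<lambda>z. z" t] by simp

lemma gap_eq: "0 < d \<Longrightarrow> gap d t = (\<integral>z. tlog d (t - z) - ln (cmod (t - z)) \<partial>\<mu>)"
  unfolding gap_def U_eq by (simp add: integrable_tlog_diff int_ln)

lemma gap_nonneg: "0 < d \<Longrightarrow> 0 \<le> gap d t"
  unfolding gap_eq using AE_neq[of t] by (intro integral_nonneg_AE) (auto elim!: eventually_mono intro: ln_le_tlog)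

lemma gap_mono: "0 < d \<Longrightarrow> d \<le> d' \<Longrightarrow> gap d t \<le> gap d' t"
  unfolding gap_def by (intro diff_right_mono integral_mono integrable_tlog_diff tlog_mono) auto

text \<open>The truncated potential is \<open>1 / d\<close>-Lipschitz and \<open>U\<close> is
  continuous by assumption; this supplies the open sets of Dini's argument.\<close>

lemma continuous_on_gap:
  assumes d: "0 < d"
  shows "continuous_on UNIV (gap d)"
proof -
  have "\<bar>(\<integral>z. tlog d (t - z) \<partial>\<mu>) - (\<integral>z. tlog d (s - z) \<partial>\<mu>)\<bar> \<le> 1 / d * dist t s" for s t
  proof -
    have "\<bar>(\<integral>z. tlog d (t - z) \<partial>\<mu>) - (\<integral>z. tlog d (s - z) \<partial>\<mu>)\<bar> =
        \<bar>\<integral>z. tlog d (t - z) - tlog d (s - z) \<partial>\<mu>\<bar>"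
      using d by (simp add: integrable_tlog_diff)
    also have "\<dots> \<le> (\<integral>z. 1 / d * dist t s \<partial>\<mu>)"
    proof (rule integral_abs_bound_integral)
      show "\<bar>tlog d (t - x) - tlog d (s - x)\<bar> \<le> 1 / d * dist t s" for x
        using tlog_diff_le_norm[OF d, of "t - x" "s - x"] by (simp add: dist_norm)
    qed (use d in \<open>auto simp: integrable_tlog_diff\<close>)
    finally show ?thesis using prob_space by simp
  qed
  then have "(1 / d)-lipschitz_on UNIV (\<lambda>t. \<integral>z. tlog d (t - z) \<partial>\<mu>)"
    using d by (intro lipschitz_onI) (auto simp: dist_real_def)
  then show ?thesis
    unfolding gap_def by (intro continuous_intros cont_U lipschitz_on_continuous_on)
qed

text \<open>For almost every \<open>z\<close> the truncated kernel eventually equals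
  \<open>ln (cmod (t - z))\<close>. For levels up to \<open>1\<close> it lies between this value and
  \<open>tlog 1 (t - z)\<close>, both integrable, so convergence is dominated.\<close>

lemma gap_tendsto_zero: "(\<lambda>n. gap (1 / real (Suc n)) t) \<longlonglongrightarrow> 0"
proof -
  have "(\<lambda>n. \<integral>z. tlog (1 / real (Suc n)) (t - z) \<partial>\<mu>) \<longlonglongrightarrow> (\<integral>z. ln (cmod (t - z)) \<partial>\<mu>)"
  proof (rule integral_dominated_convergence)
    show "integrable \<mu> (\<lambda>z. \<bar>tlog 1 (t - z)\<bar> + \<bar>ln (cmod (t - z))\<bar>)"
      by (intro Bochner_Integration.integrable_add integrable_abs integrable_tlog_diff int_ln) simp
    show "AE z in \<mu>. (\<lambda>n. tlog (1 / real (Suc n)) (t - z)) \<longlonglongrightarrow> ln (cmod (t - z))"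
      using AE_neq[of t]
    proof eventually_elim
      case (elim z)
      have "(\<lambda>n. 1 / real (Suc n)) \<longlonglongrightarrow> 0" by (rule LIMSEQ_Suc[OF lim_1_over_n])
      then have "\<forall>\<^sub>F n in sequentially. 1 / real (Suc n) < cmod (t - z)"
        by (rule order_tendstoD) (use elim in simp)
      then have "\<forall>\<^sub>F n in sequentially. tlog (1 / real (Suc n)) (t - z) = ln (cmod (t - z))"
        by eventually_elim (simp add: tlog_eq_ln)
      then show ?case by (rule tendsto_eventually)
    qed
    show "AE z in \<mu>. norm (tlog (1 / real (Suc n)) (t - z)) \<le> \<bar>tlog 1 (t - z)\<bar> + \<bar>ln (cmod (t - z))\<bar>" for n
      using AE_neq[of t]
    proof eventually_elim
      case (elim z)
      have "tlog (1 / real (Suc n)) (t - z) \<le> tlog 1 (t - z)" by (intro tlog_mono) auto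
      moreover have "ln (cmod (t - z)) \<le> tlog (1 / real (Suc n)) (t - z)"
        using elim by (intro ln_le_tlog) auto
      ultimately show ?case unfolding real_norm_def by linarith
    qed
  qed measurable
  from tendsto_diff[OF this tendsto_const[of "U t"]] show ?thesis
    by (simp add: gap_def U_eq)
qed

section \<open>Behaviour of the gap at infinity\<close>

lemma tlog_one_integral_at_infinity:
  "((\<lambda>t. (\<integral>z. tlog 1 (t - z) \<partial>\<mu>) - ln (cmod t)) \<longlongrightarrow> 0) at_infinity"
proof (rule tendstoI, rule ccontr)
  fix e :: real assume e: "0 < e"
  define G where "G = (\<lambda>t. (\<integral>z. tlog 1 (t - z) \<partial>\<mu>) - ln (cmod t))"
  assume "\<not> (\<forall>\<^sub>F t in at_infinity. dist ((\<integral>z. tlog 1 (t - z) \<partial>\<mu>) - ln (cmod t)) 0 < e)"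
  \<comment> \<open>A failure is witnessed along a sequence, to which dominated convergence applies
    with majorant \<open>ln (1 + cmod z)\<close>. The offset \<open>2\<close> ensures
    \<open>tlog 1 (t n) = ln (cmod (t n))\<close>.\<close>
  then have "\<forall>n. \<exists>t. real n + 2 \<le> cmod t \<and> \<not> dist (G t) 0 < e"
    by (auto simp: eventually_at_infinity G_def)
  then obtain t where t: "\<And>n. real n + 2 \<le> cmod (t n)" "\<And>n. \<not> dist (G (t n)) 0 < e"
    by metis
  have t2: "2 \<le> cmod (t n)" for n using t(1)[of n] by linarith
  have Gt: "G (t n) = (\<integral>z. tlog 1 (t n - z) - tlog 1 (t n) \<partial>\<mu>)" for n
    using t2[of n] prob_space by (simp add: G_def integrable_tlog_diff tlog_eq_ln)
  have tinf: "filterlim (\<lambda>n. cmod (t n)) at_top sequentially"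
  proof (rule filterlim_at_top_mono[OF filterlim_real_sequentially])
    show "\<forall>\<^sub>F n in sequentially. real n \<le> cmod (t n)"
    proof (rule always_eventually, rule allI)
      fix n show "real n \<le> cmod (t n)" using t(1)[of n] by linarith
    qed
  qed
  have "(\<lambda>n. \<integral>z. tlog 1 (t n - z) - tlog 1 (t n) \<partial>\<mu>) \<longlonglongrightarrow> (\<integral>z. 0 \<partial>\<mu>)"
  proof (rule integral_dominated_convergence[OF _ _ int_log])
    show "AE z in \<mu>. (\<lambda>n. tlog 1 (t n - z) - tlog 1 (t n)) \<longlonglongrightarrow> 0"
    proof (rule AE_I2)
      fix z
      have "(\<lambda>n. 2 * cmod z / cmod (t n)) \<longlonglongrightarrow> 0"
        by (rule tendsto_divide_0[OF tendsto_const filterlim_at_top_imp_at_infinity[OF tinf]])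
      moreover have "\<forall>\<^sub>F n in sequentially. 2 * cmod z \<le> cmod (t n)"
        using tinf by (simp add: filterlim_at_top)
      then have "\<forall>\<^sub>F n in sequentially. norm (tlog 1 (t n - z) - tlog 1 (t n)) \<le> 2 * cmod z / cmod (t n)"
        by eventually_elim (use tlog_one_diff_le_at_infinity t2 in auto)
      ultimately show "(\<lambda>n. tlog 1 (t n - z) - tlog 1 (t n)) \<longlonglongrightarrow> 0"
        by (rule Lim_null_comparison[rotated])
    qed
    show "AE z in \<mu>. norm (tlog 1 (t n - z) - tlog 1 (t n)) \<le> ln (1 + cmod z)" for n
      using tlog_diff_le[of 1 "t n - _" "t n"] by (intro AE_I2) auto
  qed measurable
  then have "(\<lambda>n. G (t n)) \<longlonglongrightarrow> 0" by (simp add: Gt)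
  then have "\<forall>\<^sub>F n in sequentially. dist (G (t n)) 0 < e" using e by (rule tendstoD)
  with t(2) show False by simp
qed

lemma measure_outside_tendsto_zero: "(\<lambda>n. prob {z. real n \<le> cmod z}) \<longlonglongrightarrow> 0"
proof -
  have "(\<lambda>n. prob {z. real n \<le> cmod z}) \<longlonglongrightarrow> prob (\<Inter>n. {z. real n \<le> cmod z})"
    by (rule finite_Lim_measure_decseq) (auto simp: decseq_def intro: order_trans)
  moreover have "(\<Inter>n. {z::complex. real n \<le> cmod z}) = {}"
  proof -
    have "\<exists>n. cmod z < real n" for z :: complex by (rule reals_Archimedean2)
    then show ?thesis by (force simp flip: not_le)
  qed
  ultimately show ?thesis by simp
qed

text \<open>
  The kernel of \<open>gap 1\<close> is unbounded, so a small mass near a point does not make \<open>gap 1\<close> small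
  there. It is integrable along horizontal segments, uniformly in their position, so a small mass
  makes the average small.
\<close>

lemma gap_one_segment_average:
  fixes n :: nat
  assumes "\<And>s. 0 \<le> s \<Longrightarrow> s \<le> 1 \<Longrightarrow> b \<le> gap 1 (of_real (real n + 1 + s))" "0 \<le> b"
  shows "b \<le> 8 * prob {z. real n \<le> cmod z}"
proof -
  define f where "f = (\<lambda>w. ennreal (tlog 1 w - ln (cmod w)))"
  have [measurable]: "f \<in> borel_measurable borel" unfolding f_def by measurable
  define T where "T = (\<lambda>s z. of_real (real n + 1 + s) - z :: complex)"
  have Tm [measurable]: "case_prod T \<in> borel_measurable (lborel \<Otimes>\<^sub>M \<mu>)"
    unfolding T_def by measurable
  have D1: "ennreal (gap 1 t) = (\<integral>\<^sup>+z. f (t - z) \<partial>\<mu>)" for t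
    unfolding f_def gap_eq[OF zero_less_one]
  proof (rule nn_integral_eq_integral[symmetric])
    show "AE z in \<mu>. 0 \<le> tlog 1 (t - z) - ln (cmod (t - z))"
      using AE_neq[of t] by eventually_elim (simp add: ln_le_tlog)
  qed (simp add: integrable_tlog_diff int_ln)
  have "ennreal b = (\<integral>\<^sup>+s. ennreal b * indicator {0..1::real} s \<partial>lborel)"
    by (subst nn_integral_cmult_indicator) auto
  also have "\<dots> \<le> (\<integral>\<^sup>+s. (\<integral>\<^sup>+z. f (T s z) \<partial>\<mu>) * indicator {0..1} s \<partial>lborel)"
    unfolding T_def D1[symmetric] using assms
    by (intro nn_integral_mono) (auto split: split_indicator intro!: ennreal_leI)
  also have "\<dots> = (\<integral>\<^sup>+s. (\<integral>\<^sup>+z. f (T s z) * indicator {0..1} s \<partial>\<mu>) \<partial>lborel)"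
    by (intro nn_integral_cong) (simp add: nn_integral_multc[symmetric] T_def)
  also have "\<dots> = (\<integral>\<^sup>+z. (\<integral>\<^sup>+s. f (T s z) * indicator {0..1} s \<partial>lborel) \<partial>\<mu>)"
  proof -
    interpret pair_sigma_finite lborel \<mu> ..
    show ?thesis by (rule Fubini'[symmetric]) (simp add: T_def split_beta')
  qed
  also have "\<dots> \<le> (\<integral>\<^sup>+z. 8 * indicator {z. real n \<le> cmod z} z \<partial>\<mu>)"
  proof (rule nn_integral_mono)
    fix z :: complex
    show "(\<integral>\<^sup>+s. f (T s z) * indicator {0..1} s \<partial>lborel) \<le> 8 * indicator {z. real n \<le> cmod z} z"
    proof (cases "real n \<le> cmod z")
      case True
      define c where "c = real n + 1 - Re z"
      have "(\<integral>\<^sup>+s. f (T s z) * indicator {0..1} s \<partial>lborel)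
          \<le> (\<integral>\<^sup>+s. ennreal (indicat_real {0..1} \<bar>c + s\<bar> * (2 * \<bar>c + s\<bar> powr (-1/2))) \<partial>lborel)"
      proof (rule nn_integral_mono_AE)
        \<comment> \<open>The single point \<open>s = - c\<close>, where the real part vanishes and
          the majorant takes the default value \<open>0\<close>, is a null set.\<close>
        show "AE s in lborel. f (T s z) * indicator {0..1} s
            \<le> ennreal (indicat_real {0..1} \<bar>c + s\<bar> * (2 * \<bar>c + s\<bar> powr (-1/2)))"
          using AE_lborel_singleton[of "- c"]
        proof eventually_elim
          case (elim s)
          have "Re (T s z) = c + s" by (simp add: T_def c_def)
          moreover from this elim have "Re (T s z) \<noteq> 0" "T s z \<noteq> 0" by auto
          ultimately have "f (T s z) \<le> ennreal (indicat_real {0..1} \<bar>c + s\<bar> * (2 * \<bar>c + s\<bar> powr (-1/2)))"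
            unfolding f_def by (metis tlog_one_minus_ln_le ennreal_leI)
          then show ?case by (auto split: split_indicator_asm split: split_indicator)
        qed
      qed
      also have "\<dots> \<le> 8" by (rule nn_integral_abs_inverse_sqrt_shift_le)
      finally show ?thesis using True by simp
    next
      case False
      \<comment> \<open>The segment starts at \<open>n + 1\<close>, so a point with
        \<open>cmod z < n\<close> is more than \<open>1\<close> away from it, where truncation at
        \<open>1\<close> changes nothing.\<close>
      have "f (T s z) = 0" if "0 \<le> s" for s
      proof -
        have "real n + 1 + s - cmod z \<le> cmod (T s z)"
          unfolding T_def using norm_triangle_ineq2[of "of_real (real n + 1 + s)" z] that
          by (simp add: norm_of_real del: of_real_add)
        then show ?thesis using False that by (simp add: f_def tlog_eq_ln)
      qed
      then have "(\<integral>\<^sup>+s. f (T s z) * indicator {0..1} s \<partial>lborel) = (\<integral>\<^sup>+s. 0 \<partial>(lborel :: real measure))"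
        by (intro nn_integral_cong) (auto split: split_indicator)
      then show ?thesis by simp
    qed
  qed
  also have "\<dots> = 8 * emeasure \<mu> {z. real n \<le> cmod z}"
    by (subst nn_integral_cmult_indicator) auto
  also have "\<dots> = ennreal (8 * prob {z. real n \<le> cmod z})"
    by (simp add: emeasure_eq_measure ennreal_mult)
  finally show ?thesis by (simp add: ennreal_le_iff)
qed

text \<open>The existence of the limit of \<open>U t - ln (cmod t)\<close> makes
  \<open>gap 1\<close> converge to \<open>- L\<close>, which is nonnegative. A positive limit would
  keep \<open>gap 1\<close> above some \<open>b > 0\<close> on all far segments, although its
  averages there are at most \<open>8\<close> times the mass outside large discs.\<close>

lemma gap_one_at_infinity: "(gap 1 \<longlongrightarrow> 0) at_infinity"
proof -
  have "((\<lambda>t. ((\<integral>z. tlog 1 (t - z) \<partial>\<mu>) - ln (cmod t)) - (U t - ln (cmod t))) \<longlongrightarrow> 0 - L) at_infinity"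
    by (intro tendsto_diff tlog_one_integral_at_infinity lim_U)
  then have lim: "(gap 1 \<longlongrightarrow> - L) at_infinity" by (simp add: gap_def[abs_def])
  have "0 \<le> - L"
    by (rule tendsto_lowerbound[OF lim]) (auto simp: gap_nonneg trivial_limit_at_infinity)
  moreover have "\<not> 0 < - L"
  proof
    assume pos: "0 < - L"
    define b where "b = - L / 2"
    have b: "0 < b" "b < - L" using pos by (auto simp: b_def)
    have "\<forall>\<^sub>F t in at_infinity. b < gap 1 t" using lim b(2) by (rule order_tendstoD)
    then obtain R where R: "\<And>t. R \<le> cmod t \<Longrightarrow> b < gap 1 t"
      by (auto simp: eventually_at_infinity)
    have "\<forall>\<^sub>F n in sequentially. b \<le> 8 * prob {z. real n \<le> cmod z}"
      using eventually_ge_at_top[of "nat \<lceil>R\<rceil>"]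
    proof eventually_elim
      case (elim n)
      then have "R \<le> real n" by linarith
      then show ?case
        using b(1) by (intro gap_one_segment_average less_imp_le[OF R]) (auto simp del: of_real_add)
    qed
    moreover have "(\<lambda>n. 8 * prob {z. real n \<le> cmod z}) \<longlonglongrightarrow> 8 * 0"
      by (intro tendsto_intros measure_outside_tendsto_zero)
    ultimately have "b \<le> 8 * 0" by (intro tendsto_lowerbound) auto
    with b(1) show False by simp
  qed
  ultimately have "L = 0" by simp
  with lim show ?thesis by simp
qed

text \<open>Outside a disc \<open>gap 1\<close> is already small. On the closed disc the open sets
  \<open>S n\<close> form a cover, finitely many suffice, and by monotonicity in \<open>d\<close>
  the smallest of the finitely many levels works everywhere.\<close>

lemma gap_uniformly_small:
  assumes e: "0 < e"
  obtains d where "0 < d" "\<And>t. 0 \<le> gap d t" "\<And>t. gap d t < e"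
proof -
  have "\<forall>\<^sub>F t in at_infinity. gap 1 t < e" using gap_one_at_infinity e by (rule order_tendstoD)
  then obtain R where R: "\<And>t. R \<le> cmod t \<Longrightarrow> gap 1 t < e"
    by (auto simp: eventually_at_infinity)
  define S where "S = (\<lambda>n. {t. gap (1 / real (Suc n)) t < e})"
  have "open (S n)" for n
    unfolding S_def using continuous_on_gap[of "1 / real (Suc n)"]
    by (intro open_Collect_less) auto
  moreover have "cball 0 R \<subseteq> (\<Union>n. S n)"
  proof
    fix t :: complex
    have "\<forall>\<^sub>F n in sequentially. gap (1 / real (Suc n)) t < e"
      using gap_tendsto_zero e by (rule order_tendstoD)
    then show "t \<in> (\<Union>n. S n)" by (auto simp: S_def dest: eventually_happens)
  qed
  ultimately obtain M where M: "finite M" "cball 0 R \<subseteq> (\<Union>n\<in>M. S n)"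
    by (meson compactE_image compact_cball subset_UNIV)
  obtain m where m: "\<And>n. n \<in> M \<Longrightarrow> n \<le> m" using M(1) finite_nat_set_iff_bounded_le by auto
  define d where "d = 1 / real (Suc m)"
  have d: "0 < d" "d \<le> 1" by (auto simp: d_def)
  have "gap d t < e" for t
  proof (cases "cmod t \<le> R")
    case True
    then obtain n where n: "n \<in> M" "gap (1 / real (Suc n)) t < e" using M(2) by (auto simp: S_def)
    have "d \<le> 1 / real (Suc n)" unfolding d_def using m[OF n(1)] by (intro divide_left_mono) auto
    then have "gap d t \<le> gap (1 / real (Suc n)) t" by (intro gap_mono d)
    then show ?thesis using n(2) by linarith
  next
    case False
    then show ?thesis using R[of t] gap_mono[OF d, of t] by linarith
  qed
  with d(1) gap_nonneg[OF d(1)] show ?thesis by (rule that)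
qed

end

subsection \<open>The extended-real integrals and the theorem\<close>

lemma borel_measurable_elog [measurable]: "elog \<in> borel_measurable borel"
  unfolding elog_def by measurable

lemma elog_pos: "0 < x \<Longrightarrow> elog x = ereal (ln x)"
  by (simp add: elog_def)

lemma max_elog:
  assumes "0 < max a b"
  shows "max (elog a) (elog b) = ereal (ln (max a b))"
  using assms by (cases "a \<le> 0"; cases "b \<le> 0"; cases "a \<le> b") (auto simp: elog_def max_def)

theorem theorem1p2:
  fixes \<mu> :: "complex measure" and V :: "complex \<Rightarrow> real" and \<epsilon> :: real
  assumes "sets \<mu> = sets borel"
    and "prob_space \<mu>"
    and "\<And>t. log_potential \<mu> t = ereal (V t)"
    and "\<exists>L::real. ((\<lambda>t. V t - ln (cmod t)) \<longlongrightarrow> L) at_infinity"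
    and "(\<integral>\<^sup>+ t. e2ennreal \<bar>elog (cmod t)\<bar> \<partial>\<mu>) < \<infinity>"
    and "continuous_on UNIV V"
    and "\<epsilon> > 0"
  shows "\<exists>(N::nat) (p::complex poly) (q::complex poly).
           N > 0 \<and> degree p = N \<and> degree q = N \<and>
           (\<forall>t. \<bar>ereal (V t) - ereal (1 / real N) *
                  max (elog (cmod (poly p t))) (elog (cmod (poly q t)))\<bar> < ereal \<epsilon>)"
proof -
  interpret prob_space \<mu> by fact
  note sets_eq [measurable_cong] = assms(1)
  \<comment> \<open>At \<open>0\<close> the integrand of the logarithmic moment is infinite, so its
    finite integral rules out mass there. This also makes the convention \<open>t / 0 = 0\<close>
    harmless.\<close>
  have AE0: "AE z in \<mu>. z \<noteq> 0"
  proof -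
    have "AE z in \<mu>. e2ennreal \<bar>elog (cmod z)\<bar> \<noteq> \<infinity>"
      using assms(5) by (intro nn_integral_PInf_AE) auto
    then show ?thesis by eventually_elim (auto simp: elog_def)
  qed
  have int_ln0: "integrable \<mu> (\<lambda>z. ln (cmod z))"
  proof (rule integrableI_bounded)
    have "(\<integral>\<^sup>+ z. ennreal (norm (ln (cmod z))) \<partial>\<mu>) = (\<integral>\<^sup>+ t. e2ennreal \<bar>elog (cmod t)\<bar> \<partial>\<mu>)"
      using AE0 by (intro nn_integral_cong_AE) (auto elim!: eventually_mono simp: elog_pos e2ennreal_ereal)
    then show "(\<integral>\<^sup>+ z. ennreal (norm (ln (cmod z))) \<partial>\<mu>) < \<infinity>" using assms(5) by simp
  qed measurable
  have int_log: "integrable \<mu> (\<lambda>z. ln (1 + cmod z))"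
  proof (rule Bochner_Integration.integrable_bound)
    show "integrable \<mu> (\<lambda>z. ln 2 + \<bar>ln (cmod z)\<bar>)" using int_ln0 by simp
    show "AE z in \<mu>. norm (ln (1 + cmod z)) \<le> norm (ln 2 + \<bar>ln (cmod z)\<bar>)"
      using AE0
    proof eventually_elim
      case (elim z)
      have "ln (1 + cmod z) \<le> ln (2 * max 1 (cmod z))"
        by (subst ln_le_cancel_iff) (auto intro: add_pos_nonneg)
      also have "\<dots> = ln 2 + ln (max 1 (cmod z))" by (intro ln_mult_pos) auto
      also have "\<dots> \<le> ln 2 + \<bar>ln (cmod z)\<bar>" by (auto simp: max_def)
      finally show ?case by simp
    qed
  qed measurable
  define c where "c = (\<integral>z. ln (cmod z) \<partial>\<mu>)"
  \<comment> \<open>Passage from the kernel \<open>1 - t / z\<close> to \<open>t - z\<close>: the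
    two logarithms differ by \<open>ln (cmod z)\<close>, whose integral is the constant
    \<open>c\<close>.\<close>
  have key: "(AE z in \<mu>. t - z \<noteq> 0) \<and> integrable \<mu> (\<lambda>z. ln (cmod (t - z))) \<and>
      V t + c = (\<integral>z. ln (cmod (t - z)) \<partial>\<mu>)" for t
  proof -
    define P where "P = (\<integral>\<^sup>+ z. e2ennreal (elog (cmod (1 - t / z))) \<partial>\<mu>)"
    define Q where "Q = (\<integral>\<^sup>+ z. e2ennreal (- elog (cmod (1 - t / z))) \<partial>\<mu>)"
    have PQ: "enn2ereal P - enn2ereal Q = ereal (V t)"
      using assms(3)[of t] by (simp add: log_potential_def ereal_integral_def P_def Q_def)
    \<comment> \<open>Since \<open>\<infinity> - \<infinity>\<close> is \<open>\<infinity>\<close>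
      here, a real value of the difference forces both parts to be finite.\<close>
    have fin: "P \<noteq> \<infinity>" "Q \<noteq> \<infinity>"
      using PQ by (cases P; cases Q; simp)+
    \<comment> \<open>The negative part is infinite at \<open>z = t\<close> when
      \<open>t \<noteq> 0\<close>, so finiteness of \<open>Q\<close> excludes an atom at
      \<open>t\<close>.\<close>
    have "AE z in \<mu>. e2ennreal (- elog (cmod (1 - t / z))) \<noteq> \<infinity>"
      using fin(2) unfolding Q_def by (intro nn_integral_PInf_AE) auto
    then have AE1: "AE z in \<mu>. 1 - t / z \<noteq> 0"
      by eventually_elim (auto simp: elog_def)
    have neq: "AE z in \<mu>. t - z \<noteq> 0"
      using AE0 AE1 by eventually_elim auto
    define g where "g = (\<lambda>z. ln (cmod (1 - t / z)))"
    have [measurable]: "g \<in> borel_measurable \<mu>" unfolding g_def by measurable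
    have gP: "(\<integral>\<^sup>+ z. ennreal (g z) \<partial>\<mu>) = P"
      unfolding P_def using AE1 by (intro nn_integral_cong_AE) (auto elim!: eventually_mono simp: elog_pos g_def e2ennreal_ereal)
    have gQ: "(\<integral>\<^sup>+ z. ennreal (- g z) \<partial>\<mu>) = Q"
      unfolding Q_def using AE1 by (intro nn_integral_cong_AE) (auto elim!: eventually_mono simp: elog_pos g_def e2ennreal_ereal)
    have g_int: "integrable \<mu> g"
      using fin gP gQ by (simp add: real_integrable_def)
    have "(\<integral>z. g z \<partial>\<mu>) = enn2real P - enn2real Q"
      using real_lebesgue_integral_def[OF g_int] gP gQ by simp
    also have "\<dots> = V t"
      using PQ fin by (cases P; cases Q) (simp_all add: enn2ereal_ennreal)
    finally have g_eq: "(\<integral>z. g z \<partial>\<mu>) = V t" .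
    have split: "AE z in \<mu>. g z + ln (cmod z) = ln (cmod (t - z))"
      using AE0 AE1
    proof eventually_elim
      case (elim z)
      have "cmod (t - z) = cmod (1 - t / z) * cmod z"
        using elim by (simp add: norm_mult[symmetric] left_diff_distrib norm_minus_commute)
      then show ?case using elim by (simp add: g_def ln_mult_pos)
    qed
    have "integrable \<mu> (\<lambda>z. g z + ln (cmod z))" using g_int int_ln0 by simp
    then have "integrable \<mu> (\<lambda>z. ln (cmod (t - z)))"
      by (subst integrable_cong_AE[OF _ _ split, symmetric]) auto
    moreover have "(\<integral>z. g z + ln (cmod z) \<partial>\<mu>) = (\<integral>z. ln (cmod (t - z)) \<partial>\<mu>)"
      by (rule integral_cong_AE) (use split in auto)
    ultimately show ?thesis using neq g_int int_ln0 by (simp add: g_eq c_def)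
  qed
  obtain L where L: "((\<lambda>t. V t - ln (cmod t)) \<longlongrightarrow> L) at_infinity" using assms(4) by blast
  interpret cont_potential \<mu> "\<lambda>t. V t + c" "L + c"
  proof unfold_locales
    show "((\<lambda>t. V t + c - ln (cmod t)) \<longlongrightarrow> L + c) at_infinity"
      using tendsto_add[OF L tendsto_const[of c]] by (simp add: algebra_simps)
    show "continuous_on UNIV (\<lambda>t. V t + c)" by (intro continuous_intros assms(6))
  qed (use key int_log assms(1) in auto)
  obtain d where d: "0 < d" "\<And>t. 0 \<le> gap d t" "\<And>t. gap d t < \<epsilon> / 2"
    using gap_uniformly_small[of "\<epsilon> / 2"] assms(7) by auto
  obtain N p q where N: "0 < N" "degree p = N" "degree q = N"
    and pos: "\<And>t. 0 < max (cmod (poly p t)) (cmod (poly q t))"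
    and appr: "\<And>t. \<bar>(\<integral>z. tlog d (t - z) \<partial>\<mu>) - 1 / real N * ln (max (cmod (poly p t)) (cmod (poly q t)))\<bar> < \<epsilon> / 2"
    using poly_pair_approx_smoothed_potential[OF d(1), of "\<epsilon> / 2"] assms(7) by auto
  \<comment> \<open>Scaling both polynomials by \<open>b\<close> adds \<open>ln b / N = - c\<close>
    to the approximant, which undoes the shift from \<open>V\<close> to \<open>V + c\<close> and
    keeps the degrees.\<close>
  define b where "b = exp (- real N * c)"
  have b: "0 < b" by (simp add: b_def)
  have "\<bar>ereal (V t) - ereal (1 / real N) *
      max (elog (cmod (poly (smult (of_real b) p) t))) (elog (cmod (poly (smult (of_real b) q) t)))\<bar> < ereal \<epsilon>" for t
  proof -
    define Y where "Y = max (cmod (poly p t)) (cmod (poly q t))"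
    have Y: "0 < Y" using pos[of t] by (simp add: Y_def)
    have "max (cmod (poly (smult (of_real b) p) t)) (cmod (poly (smult (of_real b) q) t)) = b * Y"
      using b by (simp add: norm_mult Y_def max_mult_distrib_left)
    then have "max (elog (cmod (poly (smult (of_real b) p) t))) (elog (cmod (poly (smult (of_real b) q) t))) = ereal (ln (b * Y))"
      using max_elog b Y by (metis mult_pos_pos)
    also have "ln (b * Y) = - real N * c + ln Y"
      using b Y by (simp add: ln_mult_pos b_def)
    finally have eq: "ereal (1 / real N) * max (elog (cmod (poly (smult (of_real b) p) t))) (elog (cmod (poly (smult (of_real b) q) t)))
        = ereal (1 / real N * ln Y - c)"
      using N(1) by (simp add: field_simps)
    have "\<bar>V t - (1 / real N * ln Y - c)\<bar> < \<epsilon>"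
      using appr[of t] d(2,3)[of t] unfolding gap_def Y_def[symmetric] by linarith
    then show ?thesis unfolding eq by simp
  qed
  moreover have "degree (smult (of_real b) p) = N" "degree (smult (of_real b) q) = N"
    using b N by auto
  ultimately show ?thesis using N(1) by blast
qed

end
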